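(* Let $l,u\in\mathbb R^r$ with $[l_i,u_i]\subseteq[z_l^i,z_u^i]$ for $i=1,\dots,r$. Let $\hat f^*_{[l,u]}$ and $\hat v^*_{[l,u]}$ be the optimal values of the restricted problem $(\hat P_{[l,u]})$ and of its relaxation $(\mathrm{CR}_{[l,u]})$, respectively, and let $(\bar z,\bar t)$ be the optimal solution of $(\mathrm{CR}_{[l,u]})$. Then $$\hat f(\bar z)-\hat f^*_{[l,u]}\le\hat f(\bar z)-\hat v^*_{[l,u]}\le\sum_{i=1}^{s}(\bar t_i-\bar z_i^2)\le\frac s4\|u-l\|_\infty^2,$$ $$\hat g(\bar z)\le(r+\rho_1s)\max_{i=1,\dots,r}\{\bar t_i-\bar z_i^2\}\le\frac{r+\rho_1s}{4}\|u-l\|_\infty^2,$$ where $\|\xi\|_\infty=\max_{i=1,\dots,r}|\xi_i|$ on $\mathbb R^r$.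
   Context: **Data.** $m\ge 1$ is an integer; $\Gamma,\Lambda\in\mathbb R^{m\times m}$ are arbitrary real matrices; $x_0,p_0\in\mathbb R^m$ have positive entries; $l_0>0$, $e_0:=p_0^Tx_0-l_0>0$; $\rho_1>0$ with $\rho_1e_0<l_0$. Put $l_1(y)=l_0+p_0^Ty+y^T(\Lambda+\frac12\Gamma)y$ and assume $l_1(-x_0)<0$. Vector inequalities are componentwise. **Transformed problem.** $\hat\Gamma=\frac12(\Gamma+\Gamma^T)$, $\hat\Lambda=\frac12(\Lambda+\Lambda^T)$. Write the spectral decompositions $\hat\Lambda-\frac12\hat\Gamma=B^+-B^-$ and $\hat\Lambda+\frac12\hat\Gamma=A^+-A^-$, where $B^+,A^+$ are the parts from nonnegative eigenvalues and $-B^-,-A^-$ the parts from negative eigenvalues (all four matrices $B^\pm,A^\pm$ are symmetric positive semidefinite). Let $s=\mathrm{rank}(B^-)$, $q=\mathrm{rank}(A^-)$, $r=\mathrm{rank}(B^-+A^-)$. Let $D\in\mathbb R^{m\times m}$ be a nonsingular matrix with $D^TB^-D=\mathrm{diag}(\delta_1,\dots,\delta_s,0,\dots,0)$, $D^TA^-D=\mathrm{diag}(\theta_1,\dots,\theta_r,0,\dots,0)$, where $0<\delta_i\le1$ and $\theta_i=1-\delta_i$ for $i\le s$, and $\theta_i=1$ for $s<i\le r$. Let $$\psi(z)=z^TD^T(A^++\rho_1B^+)Dz+(p_0-\rho_1\Gamma x_0)^TDz+l_0-\rho_1e_0,$$ $$\hat f(z)=z^T(D^TB^+D)z-x_0^T\Gamma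 Dz-\sum_{i=1}^s\delta_iz_i^2,\qquad \hat g(z)=\psi(z)-\sum_{i=1}^r\theta_iz_i^2-\rho_1\sum_{i=1}^s\delta_iz_i^2.$$ With $\hat D_{ij}$ the entries of $D^{-1}$: $z_l^i=-\sum_{j:\hat D_{ij}>0}\hat D_{ij}x_{0,j}$, $z_u^i=-\sum_{j:\hat D_{ij}<0}\hat D_{ij}x_{0,j}$. **Restricted problem** $(\hat P_{[l,u]})$: minimize $\hat f(z)$ over $z\in\mathbb R^m$ subject to $\hat g(z)\le0$, $-x_0\le Dz\le0$, $z_i\in[l_i,u_i]$ for $i=1,\dots,r$. **Relaxation** $(\mathrm{CR}_{[l,u]})$: minimize $z^T(D^TB^+D)z-x_0^T\Gamma Dz-\sum_{i=1}^s\delta_it_i$ over $(z,t)\in\mathbb R^m\times\mathbb R^r$ subject to $\psi(z)-\sum_{i=1}^r\theta_it_i-\rho_1\sum_{i=1}^s\delta_it_i\le0$, $-x_0\le Dz\le0$, $z_i\in[l_i,u_i]$, $z_i^2\le t_i$, $t_i\le(l_i+u_i)z_i-l_iu_i$ for $i=1,\dots,r$. *)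

theory Defs
  imports "Jordan_Normal_Form.DL_Rank" "HOL-Library.Extended_Real"
begin

text \<open>
  Matrix, vector and index-family entries are numbered from 0, so the index range
  \<open>1, \<dots>, k\<close> of the mathematics is \<open>{..<k}\<close> here.
\<close>

definition qform :: "real mat \<Rightarrow> real vec \<Rightarrow> real" where
  "qform M z = z \<bullet> (M *\<^sub>v z)"

definition sym_part :: "real mat \<Rightarrow> real mat" where
  "sym_part M = (1/2) \<cdot>\<^sub>m (M + M\<^sup>T)"

text \<open>
  \<open>M = P - N\<close>, where \<open>P\<close> collects the nonnegative eigenvalues and \<open>- N\<close> the negative ones
  in a spectral decomposition \<open>M = Q diag(\<lambda>) Q\<^sup>T\<close>.
\<close>
definition spectral_split :: "nat \<Rightarrow> real mat \<Rightarrow> real mat \<Rightarrow> real mat \<Rightarrow> bool" where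
  "spectral_split m M P N \<longleftrightarrow>
    (\<exists>Q ev. Q \<in> carrier_mat m m \<and> Q\<^sup>T * Q = 1\<^sub>m m \<and>
      M = Q * mat_diag m ev * Q\<^sup>T \<and>
      P = Q * mat_diag m (\<lambda>i. if ev i \<ge> 0 then ev i else 0) * Q\<^sup>T \<and>
      N = Q * mat_diag m (\<lambda>i. if ev i < 0 then - ev i else 0) * Q\<^sup>T)"

definition l1 :: "real mat \<Rightarrow> real mat \<Rightarrow> real vec \<Rightarrow> real \<Rightarrow> real vec \<Rightarrow> real" where
  "l1 \<Gamma> \<Lambda> p0 l0 y = l0 + p0 \<bullet> y + qform (\<Lambda> + (1/2) \<cdot>\<^sub>m \<Gamma>) y"

definition psi ::
  "real mat \<Rightarrow> real vec \<Rightarrow> real vec \<Rightarrow> real \<Rightarrow> real \<Rightarrow> real \<Rightarrow> real mat \<Rightarrow> real mat \<Rightarrow> real mat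
    \<Rightarrow> real vec \<Rightarrow> real" where
  "psi \<Gamma> x0 p0 l0 e0 \<rho>1 Bp Ap D z =
    qform (D\<^sup>T * (Ap + \<rho>1 \<cdot>\<^sub>m Bp) * D) z + (p0 - \<rho>1 \<cdot>\<^sub>v (\<Gamma> *\<^sub>v x0)) \<bullet> (D *\<^sub>v z) + l0 - \<rho>1 * e0"

definition f_hat ::
  "nat \<Rightarrow> real mat \<Rightarrow> real vec \<Rightarrow> real mat \<Rightarrow> real mat \<Rightarrow> (nat \<Rightarrow> real) \<Rightarrow> real vec \<Rightarrow> real" where
  "f_hat s \<Gamma> x0 Bp D \<delta> z =
    qform (D\<^sup>T * Bp * D) z - x0 \<bullet> (\<Gamma> *\<^sub>v (D *\<^sub>v z)) - (\<Sum>i<s. \<delta> i * (z $ i)\<^sup>2)"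

definition g_hat ::
  "nat \<Rightarrow> nat \<Rightarrow> real mat \<Rightarrow> real vec \<Rightarrow> real vec \<Rightarrow> real \<Rightarrow> real \<Rightarrow> real \<Rightarrow> real mat \<Rightarrow> real mat
    \<Rightarrow> real mat \<Rightarrow> (nat \<Rightarrow> real) \<Rightarrow> (nat \<Rightarrow> real) \<Rightarrow> real vec \<Rightarrow> real" where
  "g_hat s r \<Gamma> x0 p0 l0 e0 \<rho>1 Bp Ap D \<delta> \<theta> z =
    psi \<Gamma> x0 p0 l0 e0 \<rho>1 Bp Ap D z
      - (\<Sum>i<r. \<theta> i * (z $ i)\<^sup>2) - \<rho>1 * (\<Sum>i<s. \<delta> i * (z $ i)\<^sup>2)"

definition z_low :: "nat \<Rightarrow> real vec \<Rightarrow> real mat \<Rightarrow> nat \<Rightarrow> real" where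
  "z_low m x0 Dinv i = - (\<Sum>j | j < m \<and> Dinv $$ (i, j) > 0. Dinv $$ (i, j) * x0 $ j)"

definition z_upp :: "nat \<Rightarrow> real vec \<Rightarrow> real mat \<Rightarrow> nat \<Rightarrow> real" where
  "z_upp m x0 Dinv i = - (\<Sum>j | j < m \<and> Dinv $$ (i, j) < 0. Dinv $$ (i, j) * x0 $ j)"

definition P_feasible ::
  "nat \<Rightarrow> nat \<Rightarrow> nat \<Rightarrow> real mat \<Rightarrow> real vec \<Rightarrow> real vec \<Rightarrow> real \<Rightarrow> real \<Rightarrow> real \<Rightarrow> real mat
    \<Rightarrow> real mat \<Rightarrow> real mat \<Rightarrow> (nat \<Rightarrow> real) \<Rightarrow> (nat \<Rightarrow> real) \<Rightarrow> real vec \<Rightarrow> real vec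
    \<Rightarrow> real vec set" where
  "P_feasible m s r \<Gamma> x0 p0 l0 e0 \<rho>1 Bp Ap D \<delta> \<theta> l u =
    {z \<in> carrier_vec m.
       g_hat s r \<Gamma> x0 p0 l0 e0 \<rho>1 Bp Ap D \<delta> \<theta> z \<le> 0 \<and>
       - x0 \<le> D *\<^sub>v z \<and> D *\<^sub>v z \<le> 0\<^sub>v m \<and>
       (\<forall>i<r. z $ i \<in> {l $ i .. u $ i})}"

definition CR_objective ::
  "nat \<Rightarrow> real mat \<Rightarrow> real vec \<Rightarrow> real mat \<Rightarrow> real mat \<Rightarrow> (nat \<Rightarrow> real)
    \<Rightarrow> real vec \<times> real vec \<Rightarrow> real" where
  "CR_objective s \<Gamma> x0 Bp D \<delta> = (\<lambda>(z, t).
    qform (D\<^sup>T * Bp * D) z - x0 \<bullet> (\<Gamma> *\<^sub>v (D *\<^sub>v z)) - (\<Sum>i<s. \<delta> i * t $ i))"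

definition CR_feasible ::
  "nat \<Rightarrow> nat \<Rightarrow> nat \<Rightarrow> real mat \<Rightarrow> real vec \<Rightarrow> real vec \<Rightarrow> real \<Rightarrow> real \<Rightarrow> real \<Rightarrow> real mat
    \<Rightarrow> real mat \<Rightarrow> real mat \<Rightarrow> (nat \<Rightarrow> real) \<Rightarrow> (nat \<Rightarrow> real) \<Rightarrow> real vec \<Rightarrow> real vec
    \<Rightarrow> (real vec \<times> real vec) set" where
  "CR_feasible m s r \<Gamma> x0 p0 l0 e0 \<rho>1 Bp Ap D \<delta> \<theta> l u =
    {(z, t). z \<in> carrier_vec m \<and> t \<in> carrier_vec r \<and>
       psi \<Gamma> x0 p0 l0 e0 \<rho>1 Bp Ap D z
         - (\<Sum>i<r. \<theta> i * t $ i) - \<rho>1 * (\<Sum>i<s. \<delta> i * t $ i) \<le> 0 \<and>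
       - x0 \<le> D *\<^sub>v z \<and> D *\<^sub>v z \<le> 0\<^sub>v m \<and>
       (\<forall>i<r. z $ i \<in> {l $ i .. u $ i} \<and> (z $ i)\<^sup>2 \<le> t $ i \<and>
          t $ i \<le> (l $ i + u $ i) * z $ i - l $ i * u $ i)}"

text \<open>The optimal value is extended real: it is \<open>\<infinity>\<close> for an empty feasible set.\<close>
definition opt_value :: "('a \<Rightarrow> real) \<Rightarrow> 'a set \<Rightarrow> ereal" where
  "opt_value f S = (INF x\<in>S. ereal (f x))"

text \<open>
  The inserted 0 only matters in dimension 0, where it gives the norm its value 0;
  otherwise this is the maximum of the absolute values of the entries.
\<close>
definition max_norm :: "real vec \<Rightarrow> real" where
  "max_norm v = Max (insert 0 ((\<lambda>i. \<bar>v $ i\<bar>) ` {..<dim_vec v}))"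

end

theory Submission
  imports Defs
begin

text \<open>
  A point of the restricted problem lifts to the relaxation by taking \<open>t\<^sub>i = z\<^sub>i\<^sup>2\<close>,
  without changing the objective, so the relaxation bounds the restricted problem from below. At
  the optimum of the relaxation, both errors are bounded by weighted sums of the gaps
  \<open>t\<^sub>i - z\<^sub>i\<^sup>2\<close> with weights \<open>\<delta>\<^sub>i \<le> 1\<close>, \<open>\<theta>\<^sub>i \<le> 1\<close> and \<open>\<rho>1 \<delta>\<^sub>i \<le> \<rho>1\<close>, and a gap is at most
  \<open>(z\<^sub>i - l\<^sub>i) (u\<^sub>i - z\<^sub>i) \<le> (u\<^sub>i - l\<^sub>i)\<^sup>2 / 4\<close>. The inequality \<open>s \<le> r\<close>, needed to bound the first
  \<open>s\<close> gaps, holds because \<open>D\<close> diagonalises \<open>Bm\<close> and \<open>Am\<close> simultaneously and the support of the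
  diagonal of \<open>Bm\<close> is contained in that of \<open>Bm + Am\<close>.
\<close>

text \<open>Every vector \<open>(A * C) *\<^sub>v x\<close> is \<open>A\<close> applied to
  \<open>C *\<^sub>v x\<close>, so right multiplication can only shrink the column space.\<close>

lemma (in vec_space) rank_mult_le:
  assumes A: "A \<in> carrier_mat n k" and C: "C \<in> carrier_mat k j"
  shows "rank (A * C) \<le> rank A"
proof -
  have AC: "A * C \<in> carrier_mat n j"
    using A C by simp
  have "col_space (A * C) \<subseteq> col_space A"
  proof
    fix y assume "y \<in> col_space (A * C)"
    then obtain x where x: "x \<in> carrier_vec j" and y: "y = (A * C) *\<^sub>v x"
      using col_space_eq[OF AC] AC by auto
    have "y = A *\<^sub>v (C *\<^sub>v x)"
      using y assoc_mult_mat_vec[OF A C x] by simp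
    moreover have "C *\<^sub>v x \<in> carrier_vec k"
      using C x by auto
    ultimately show "y \<in> col_space A"
      using col_space_eq[OF A] A by auto
  qed
  then have sub: "span (set (cols (A * C))) \<subseteq> span (set (cols A))"
    by (simp add: col_space_def)
  have A_sub: "VectorSpace.subspace class_ring (span (set (cols A))) V"
    using span_is_subspace A cols_dim by blast
  have AC_sub: "VectorSpace.subspace class_ring (span (set (cols (A * C)))) V"
    using span_is_subspace AC cols_dim by blast
  show ?thesis
    unfolding rank_def
    using vectorspace.subspace_dim[OF subspace_is_vs[OF A_sub]
        nested_subspaces[OF A_sub AC_sub sub] fin_dim_span_cols[OF A]]
      fin_dim_span_cols[OF AC]
    by simp
qed

text \<open>The support condition lets one diagonal be written as the other times a diagonal factor
  \<open>E\<close>. Undoing the congruence by \<open>D\<close> turns this into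
  \<open>M = N * (D * E * Dinv)\<close>, a right multiple of \<open>N\<close>.\<close>

lemma rank_mono_of_simultaneous_diagonalisation:
  fixes M N D Dinv :: "'a :: field mat"
  assumes M: "M \<in> carrier_mat m m" and N: "N \<in> carrier_mat m m"
    and D: "D \<in> carrier_mat m m" and Dinv: "Dinv \<in> carrier_mat m m"
    and inv: "D * Dinv = 1\<^sub>m m"
    and DM: "D\<^sup>T * M * D = mat_diag m f" and DN: "D\<^sup>T * N * D = mat_diag m g"
    and supp: "\<And>i. i < m \<Longrightarrow> g i = 0 \<Longrightarrow> f i = 0"
  shows "vec_space.rank m M \<le> vec_space.rank m N"
proof -
  define E where "E = mat_diag m (\<lambda>i. f i / g i)"
  have E: "E \<in> carrier_mat m m"
    by (simp add: E_def)
  \<comment> \<open>Where \<open>g i = 0\<close>, the quotient is 0 by convention and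
    \<open>f i = 0\<close> by \<open>supp\<close>, so the product is still
    \<open>f i\<close>.\<close>
  have "mat_diag m (\<lambda>i. g i * (f i / g i)) = mat_diag m f"
    using supp by (intro eq_matI) (auto simp: mat_diag_def)
  then have E_eq: "D\<^sup>T * M * D * 1\<^sub>m m = D\<^sup>T * N * D * E"
    by (simp add: DM DN E_def right_mult_one_mat[OF mat_diag_dim])
  have inv': "Dinv\<^sup>T * D\<^sup>T = 1\<^sub>m m"
    using transpose_mult[OF D Dinv] inv by simp
  \<comment> \<open>The free factor \<open>Y\<close> lets one identity serve both sides of
    \<open>E_eq\<close>: \<open>Y\<close> is the identity matrix for \<open>M\<close> and
    \<open>E\<close> for \<open>N\<close>.\<close>
  have undo: "Dinv\<^sup>T * (D\<^sup>T * X * D * Y) * Dinv = X * (D * Y * Dinv)"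
    if X: "X \<in> carrier_mat m m" and Y: "Y \<in> carrier_mat m m" for X Y
  proof -
    have T: "D\<^sup>T \<in> carrier_mat m m" "Dinv\<^sup>T \<in> carrier_mat m m"
      using D Dinv by auto
    have "D\<^sup>T * X * D * Y = D\<^sup>T * (X * (D * Y))"
      using T X D Y by (simp add: assoc_mult_mat[of _ m m _ m _ m])
    then have "Dinv\<^sup>T * (D\<^sup>T * X * D * Y) = Dinv\<^sup>T * D\<^sup>T * (X * (D * Y))"
      using T X D Y by (simp add: assoc_mult_mat[of _ m m _ m _ m])
    then show ?thesis
      using X D Y Dinv by (simp add: inv' assoc_mult_mat[of _ m m _ m _ m])
  qed
  have "M = M * (D * 1\<^sub>m m * Dinv)"
    using M D inv by simp
  also have "\<dots> = Dinv\<^sup>T * (D\<^sup>T * M * D * 1\<^sub>m m) * Dinv"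
    using undo[OF M, of "1\<^sub>m m"] by simp
  also note E_eq
  also have "Dinv\<^sup>T * (D\<^sup>T * N * D * E) * Dinv = N * (D * E * Dinv)"
    by (rule undo[OF N E])
  finally have "M = N * (D * E * Dinv)" .
  then show ?thesis
    using vec_space.rank_mult_le[OF N, of "D * E * Dinv" m] D E Dinv by simp
qed

lemma spectral_split_carrier:
  assumes "spectral_split m M P N"
  shows "P \<in> carrier_mat m m" "N \<in> carrier_mat m m"
  using assms by (auto simp: spectral_split_def)

lemma mat_diag_add: "mat_diag n f + mat_diag n g = mat_diag n (\<lambda>i. f i + g i :: 'a :: monoid_add)"
  by (intro eq_matI) (auto simp: mat_diag_def)

lemma abs_index_le_max_norm: "i < dim_vec v \<Longrightarrow> \<bar>v $ i\<bar> \<le> max_norm v"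
  unfolding max_norm_def by (intro Max_ge) auto

text \<open>The chord of the square over \<open>[a, b]\<close> exceeds it by
  \<open>(x - a) * (b - x)\<close>, which is largest at the midpoint; completing the square there
  gives the constant 1/4.\<close>

lemma secant_gap_le:
  fixes x y a b :: real
  assumes "y \<le> (a + b) * x - a * b"
  shows "y - x\<^sup>2 \<le> (b - a)\<^sup>2 / 4"
proof -
  have "(b - a)\<^sup>2 / 4 - ((a + b) * x - a * b - x\<^sup>2) = (x - (a + b) / 2)\<^sup>2"
    by (simp add: power2_eq_square field_simps)
  then have "(a + b) * x - a * b - x\<^sup>2 \<le> (b - a)\<^sup>2 / 4"
    using zero_le_power2[of "x - (a + b) / 2"] by linarith
  then show ?thesis
    using assms by linarith
qed

lemma square_le_secant:
  fixes x a b :: real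
  assumes "a \<le> x" "x \<le> b"
  shows "x\<^sup>2 \<le> (a + b) * x - a * b"
proof -
  have "0 \<le> (x - a) * (b - x)"
    using assms by simp
  then show ?thesis
    by (simp add: power2_eq_square algebra_simps)
qed

lemma opt_value_le_of_lift:
  assumes "\<And>x. x \<in> S \<Longrightarrow> h x \<in> T \<and> g (h x) = f x"
  shows "opt_value g T \<le> opt_value f S"
  unfolding opt_value_def using assms by (intro INF_mono) force

lemma opt_value_is_arg_min:
  assumes "is_arg_min f (\<lambda>x. x \<in> S) x"
  shows "opt_value f S = ereal (f x)"
  unfolding opt_value_def
proof (rule antisym)
  show "(INF y\<in>S. ereal (f y)) \<le> ereal (f x)"
    using assms by (intro INF_lower) (simp add: is_arg_min_def)
  show "ereal (f x) \<le> (INF y\<in>S. ereal (f y))"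
    using assms by (intro INF_greatest) (auto simp: is_arg_min_linorder)
qed

theorem theorem2:
  fixes m s q r :: nat
    and \<Gamma> \<Lambda> Bp Bm Ap Am D Dinv :: "real mat"
    and x0 p0 l u zbar tbar :: "real vec"
    and l0 e0 \<rho>1 :: real
    and \<delta> \<theta> :: "nat \<Rightarrow> real"
  assumes m: "m \<ge> 1"
    and \<Gamma>: "\<Gamma> \<in> carrier_mat m m"
    and \<Lambda>: "\<Lambda> \<in> carrier_mat m m"
    and x0: "x0 \<in> carrier_vec m" "\<forall>i<m. x0 $ i > 0"
    and p0: "p0 \<in> carrier_vec m" "\<forall>i<m. p0 $ i > 0"
    and l0: "l0 > 0"
    and e0: "e0 = p0 \<bullet> x0 - l0" "e0 > 0"
    and \<rho>1: "\<rho>1 > 0" "\<rho>1 * e0 < l0"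
    and l1: "l1 \<Gamma> \<Lambda> p0 l0 (- x0) < 0"
    and B: "spectral_split m (sym_part \<Lambda> - (1/2) \<cdot>\<^sub>m sym_part \<Gamma>) Bp Bm"
    and A: "spectral_split m (sym_part \<Lambda> + (1/2) \<cdot>\<^sub>m sym_part \<Gamma>) Ap Am"
    and s: "s = vec_space.rank m Bm"
    and q: "q = vec_space.rank m Am"
    and r: "r = vec_space.rank m (Bm + Am)"
    and D: "D \<in> carrier_mat m m" "invertible_mat D"
    and DB: "D\<^sup>T * Bm * D = mat_diag m (\<lambda>i. if i < s then \<delta> i else 0)"
    and DA: "D\<^sup>T * Am * D = mat_diag m (\<lambda>i. if i < r then \<theta> i else 0)"
    and \<delta>: "\<forall>i<s. 0 < \<delta> i \<and> \<delta> i \<le> 1"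
    and \<theta>: "\<forall>i<s. \<theta> i = 1 - \<delta> i" "\<forall>i. s \<le> i \<and> i < r \<longrightarrow> \<theta> i = 1"
    and Dinv: "Dinv \<in> carrier_mat m m" "inverts_mat D Dinv" "inverts_mat Dinv D"
    and l: "l \<in> carrier_vec r"
    and u: "u \<in> carrier_vec r"
    and lu: "\<forall>i<r. {l $ i .. u $ i} \<subseteq> {z_low m x0 Dinv i .. z_upp m x0 Dinv i}"
    and opt: "is_arg_min (CR_objective s \<Gamma> x0 Bp D \<delta>)
       (\<lambda>zt. zt \<in> CR_feasible m s r \<Gamma> x0 p0 l0 e0 \<rho>1 Bp Ap D \<delta> \<theta> l u) (zbar, tbar)"
  shows "ereal (f_hat s \<Gamma> x0 Bp D \<delta> zbar)
           - opt_value (f_hat s \<Gamma> x0 Bp D \<delta>)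
               (P_feasible m s r \<Gamma> x0 p0 l0 e0 \<rho>1 Bp Ap D \<delta> \<theta> l u)
         \<le> ereal (f_hat s \<Gamma> x0 Bp D \<delta> zbar)
           - opt_value (CR_objective s \<Gamma> x0 Bp D \<delta>)
               (CR_feasible m s r \<Gamma> x0 p0 l0 e0 \<rho>1 Bp Ap D \<delta> \<theta> l u) \<and>
         ereal (f_hat s \<Gamma> x0 Bp D \<delta> zbar)
           - opt_value (CR_objective s \<Gamma> x0 Bp D \<delta>)
               (CR_feasible m s r \<Gamma> x0 p0 l0 e0 \<rho>1 Bp Ap D \<delta> \<theta> l u)
         \<le> ereal (\<Sum>i<s. tbar $ i - (zbar $ i)\<^sup>2) \<and>
         (\<Sum>i<s. tbar $ i - (zbar $ i)\<^sup>2) \<le> real s / 4 * (max_norm (u - l))\<^sup>2 \<and>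
         g_hat s r \<Gamma> x0 p0 l0 e0 \<rho>1 Bp Ap D \<delta> \<theta> zbar
         \<le> (real r + \<rho>1 * real s) * Max ((\<lambda>i. tbar $ i - (zbar $ i)\<^sup>2) ` {..<r}) \<and>
         (real r + \<rho>1 * real s) * Max ((\<lambda>i. tbar $ i - (zbar $ i)\<^sup>2) ` {..<r})
         \<le> (real r + \<rho>1 * real s) / 4 * (max_norm (u - l))\<^sup>2"
proof -
  let ?N = "(max_norm (u - l))\<^sup>2"
  let ?gap = "\<lambda>i. tbar $ i - (zbar $ i)\<^sup>2"
  let ?P = "P_feasible m s r \<Gamma> x0 p0 l0 e0 \<rho>1 Bp Ap D \<delta> \<theta> l u"
  let ?C = "CR_feasible m s r \<Gamma> x0 p0 l0 e0 \<rho>1 Bp Ap D \<delta> \<theta> l u"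
  let ?psi = "psi \<Gamma> x0 p0 l0 e0 \<rho>1 Bp Ap D"
  have Bm: "Bm \<in> carrier_mat m m" and Am: "Am \<in> carrier_mat m m"
    using spectral_split_carrier B A by blast+
  have "D\<^sup>T * (Bm + Am) * D = D\<^sup>T * Bm * D + D\<^sup>T * Am * D"
    using Bm Am D(1) by (simp add: mult_add_distrib_mat[of _ m m] add_mult_distrib_mat[of _ m m])
  then have DBA: "D\<^sup>T * (Bm + Am) * D =
      mat_diag m (\<lambda>i. (if i < s then \<delta> i else 0) + (if i < r then \<theta> i else 0))"
    by (simp add: DB DA mat_diag_add)
  have "D * Dinv = 1\<^sub>m m"
    using Dinv D by (simp add: inverts_mat_def)
  \<comment> \<open>For \<open>i < s\<close> the diagonal entry of \<open>Bm + Am\<close> is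
    \<open>\<delta> i + \<theta> i = 1\<close> if \<open>i < r\<close>, and
    \<open>\<delta> i > 0\<close> otherwise. It is nonzero either way, so the order of
    \<open>s\<close> and \<open>r\<close> is not presupposed.\<close>
  then have sr: "s \<le> r"
    unfolding s r
    using rank_mono_of_simultaneous_diagonalisation[OF Bm _ D(1) Dinv(1) _ DB DBA] Bm Am \<delta> \<theta>(1)
    by (fastforce split: if_splits simp: s[symmetric] r[symmetric])
  have \<theta>01: "0 \<le> \<theta> i \<and> \<theta> i \<le> 1" if "i < r" for i
    using \<delta> \<theta> that by (cases "i < s") auto

  have feas: "(zbar, tbar) \<in> ?C"
    using opt by (simp add: is_arg_min_def)
  have gap0: "0 \<le> ?gap i" if "i < r" for i
    using feas that by (simp add: CR_feasible_def)
  have gapN: "?gap i \<le> ?N / 4" if "i < r" for i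
  proof -
    have "?gap i \<le> (u $ i - l $ i)\<^sup>2 / 4"
      using feas that by (intro secant_gap_le) (simp add: CR_feasible_def)
    also have "\<bar>u $ i - l $ i\<bar> \<le> max_norm (u - l)"
      using abs_index_le_max_norm[of i "u - l"] that l u by simp
    then have "(u $ i - l $ i)\<^sup>2 \<le> ?N"
      by (metis abs_ge_zero power2_abs power_mono)
    finally show ?thesis
      by simp
  qed

  have relax: "opt_value (CR_objective s \<Gamma> x0 Bp D \<delta>) ?C \<le> opt_value (f_hat s \<Gamma> x0 Bp D \<delta>) ?P"
  proof (rule opt_value_le_of_lift[where h = "\<lambda>z. (z, vec r (\<lambda>i. (z $ i)\<^sup>2))"])
    fix z assume z: "z \<in> ?P"
    \<comment> \<open>The lifted vector has length \<open>r\<close>, so evaluating its first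
      \<open>s\<close> entries requires \<open>s \<le> r\<close>.\<close>
    have sums: "(\<Sum>i<s. \<delta> i * vec r (\<lambda>i. (z $ i)\<^sup>2) $ i) = (\<Sum>i<s. \<delta> i * (z $ i)\<^sup>2)"
        "(\<Sum>i<r. \<theta> i * vec r (\<lambda>i. (z $ i)\<^sup>2) $ i) = (\<Sum>i<r. \<theta> i * (z $ i)\<^sup>2)"
      using sr by (auto intro!: sum.cong)
    show "(z, vec r (\<lambda>i. (z $ i)\<^sup>2)) \<in> ?C \<and>
        CR_objective s \<Gamma> x0 Bp D \<delta> (z, vec r (\<lambda>i. (z $ i)\<^sup>2)) = f_hat s \<Gamma> x0 Bp D \<delta> z"
      using z by (auto simp: CR_feasible_def P_feasible_def CR_objective_def f_hat_def g_hat_def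
          sums square_le_secant)
  qed
  have val: "opt_value (CR_objective s \<Gamma> x0 Bp D \<delta>) ?C = ereal (CR_objective s \<Gamma> x0 Bp D \<delta> (zbar, tbar))"
    by (rule opt_value_is_arg_min[OF opt])

  have \<delta>gap: "(\<Sum>i<s. \<delta> i * ?gap i) \<le> (\<Sum>i<s. ?gap i)"
    using \<delta> gap0 sr by (intro sum_mono mult_left_le_one_le) (auto simp: less_imp_le)
  have "f_hat s \<Gamma> x0 Bp D \<delta> zbar - CR_objective s \<Gamma> x0 Bp D \<delta> (zbar, tbar) = (\<Sum>i<s. \<delta> i * ?gap i)"
    by (simp add: f_hat_def CR_objective_def right_diff_distrib sum_subtractf)
  then have f_gap: "f_hat s \<Gamma> x0 Bp D \<delta> zbar - CR_objective s \<Gamma> x0 Bp D \<delta> (zbar, tbar) \<le> (\<Sum>i<s. ?gap i)"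
    using \<delta>gap by simp
  have sumN: "(\<Sum>i<s. ?gap i) \<le> real s / 4 * ?N"
    using sum_bounded_above[of "{..<s}" ?gap "?N / 4"] gapN sr by simp

  have g_gap: "g_hat s r \<Gamma> x0 p0 l0 e0 \<rho>1 Bp Ap D \<delta> \<theta> zbar
      \<le> (\<Sum>i<r. ?gap i) + \<rho>1 * (\<Sum>i<s. ?gap i)"
  proof -
    \<comment> \<open>Adding and subtracting \<open>tbar\<close> isolates the relaxed constraint,
      which is nonpositive by feasibility; only weighted gaps remain.\<close>
    have "g_hat s r \<Gamma> x0 p0 l0 e0 \<rho>1 Bp Ap D \<delta> \<theta> zbar
        = (?psi zbar - (\<Sum>i<r. \<theta> i * tbar $ i) - \<rho>1 * (\<Sum>i<s. \<delta> i * tbar $ i))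
          + (\<Sum>i<r. \<theta> i * ?gap i) + \<rho>1 * (\<Sum>i<s. \<delta> i * ?gap i)"
      by (simp add: g_hat_def right_diff_distrib sum_subtractf)
    also have "\<dots> \<le> 0 + (\<Sum>i<r. ?gap i) + \<rho>1 * (\<Sum>i<s. ?gap i)"
    proof (intro add_mono mult_left_mono \<delta>gap)
      show "(\<Sum>i<r. \<theta> i * ?gap i) \<le> (\<Sum>i<r. ?gap i)"
        using \<theta>01 gap0 by (intro sum_mono mult_left_le_one_le) auto
    qed (use feas \<rho>1 in \<open>auto simp: CR_feasible_def\<close>)
    finally show ?thesis
      by simp
  qed
  let ?Max = "Max (?gap ` {..<r})"
  have le_Max: "?gap i \<le> ?Max" if "i < r" for i
    using that by (intro Max_ge) auto
  have "(\<Sum>i<r. ?gap i) + \<rho>1 * (\<Sum>i<s. ?gap i) \<le> real r * ?Max + \<rho>1 * (real s * ?Max)"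
    using sum_bounded_above[of "{..<r}" ?gap ?Max] sum_bounded_above[of "{..<s}" ?gap ?Max]
      le_Max sr \<rho>1(1) by (intro add_mono mult_left_mono) auto
  then have g_Max: "g_hat s r \<Gamma> x0 p0 l0 e0 \<rho>1 Bp Ap D \<delta> \<theta> zbar \<le> (real r + \<rho>1 * real s) * ?Max"
    using g_gap by (simp only: distrib_right mult.assoc)
  have Max_N: "(real r + \<rho>1 * real s) * ?Max \<le> (real r + \<rho>1 * real s) / 4 * ?N"
  proof (cases "r = 0")
    case True
    \<comment> \<open>The maximum over the empty set is unspecified, but its coefficient vanishes.\<close>
    then show ?thesis
      using sr by simp
  next
    case False
    then have "?Max \<le> ?N / 4"
      using gapN by (subst Max_le_iff) auto
    then show ?thesis
      using mult_left_mono[of ?Max "?N / 4" "real r + \<rho>1 * real s"] \<rho>1 by simp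
  qed
  have val_gap: "ereal (f_hat s \<Gamma> x0 Bp D \<delta> zbar) - opt_value (CR_objective s \<Gamma> x0 Bp D \<delta>) ?C
      \<le> ereal (\<Sum>i<s. ?gap i)"
    using f_gap by (simp add: val)
  show ?thesis
    \<comment> \<open>Subtraction in the extended reals also covers an infeasible restricted
      problem: its value is \<infinity>, which makes the leftmost difference -\<infinity>.\<close>
    by (intro conjI ereal_minus_mono order_refl relax val_gap sumN g_Max Max_N)
qed

end
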